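(* Let $\mathbf{M}=\bigcup_{\mathcal F}M_i$ be a non-Hausdorff manifold built from an adjunction system $\mathcal F$ of countably many Hausdorff manifolds $M_i$ glued along open subsets $A_{ij}\subseteq M_i$, in which the gluing regions have homeomorphic boundaries. Then each canonical subspace $M_i$ (that is, $\phi_i(M_i)$) is an $H$-submanifold of $\mathbf{M}$.
   Context: An adjunction system $\mathcal F$ indexed by a set $I$ consists of topological spaces $X_i$, subsets $A_{ij}\subseteq X_i$ (with the subspace topology) and continuous maps $f_{ij}:A_{ij}\to X_j$ such that for all $i,j,k\in I$: (A1) $A_{ii}=X_i$ and $f_{ii}=\mathrm{id}_{X_i}$; (A2) $A_{ji}=f_{ij}(A_{ij})$ and $f_{ij}^{-1}=f_{ji}$ (so $f_{ij}$ is a homeomorphism onto $A_{ji}$); (A3) for each $a\in A_{ij}\cap A_{ik}$ one has $f_{ij}(a)\in A_{jk}$ and $f_{ik}(a)=f_{jk}(f_{ij}(a))$. The adjunction space $\bigcup_{\mathcal F}X_i$ is the quotient (with the quotient topology) of the disjoint union $\bigsqcup_i X_i$ by the equivalence relation $(x,i)\cong(y,j)$ iff $x\in A_{ij}$ and $f_{ij}(x)=y$; the class of $(x,i)$ is $[x,i]$, and $\phi_i:X_i\to\bigcup_{\mathcal F}X_i$ is the canonical injective map $x\mapsto[x,i]$. All manifolds (Hausdorff or not) are locally Euclidean, second-countable and connected; a non-Hausdorff manifold is such a space that is not Hausdorff. Here the indexing set $I$ is countable, $X_i=M_i$ are Hausdorff manifolds and every $A_{ij}$ is open in $M_i$. The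 gluing regions have homeomorphic boundaries if, for all $i\neq j$, $A_{ij}$ is a proper subset of $M_i$ and $f_{ij}$ extends to a homeomorphism $\tilde f_{ij}:\mathrm{Cl}(A_{ij})\to\mathrm{Cl}(A_{ji})$, with closures taken in $M_i$ and $M_j$ respectively. An $H$-submanifold of $\mathbf{M}$ is a subset that is open, Hausdorff and connected, and is maximal (under inclusion) among subsets with these properties. *)

theory Defs
  imports "HOL-Analysis.Analysis"
begin

section \<open>Quotient topologies\<close>

definition quotient_topology :: "'a topology \<Rightarrow> 'a rel \<Rightarrow> 'a set topology" where
  "quotient_topology X r =
     topology (\<lambda>U. U \<subseteq> topspace X // r \<and> openin X {x \<in> topspace X. r `` {x} \<in> U})"

lemma istopology_quotient:
  "istopology (\<lambda>U. U \<subseteq> topspace X // r \<and> openin X {x \<in> topspace X. r `` {x} \<in> U})"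
proof -
  have 1: "{x \<in> topspace X. r `` {x} \<in> S \<inter> T} =
      {x \<in> topspace X. r `` {x} \<in> S} \<inter> {x \<in> topspace X. r `` {x} \<in> T}" for S T
    by auto
  have 2: "{x \<in> topspace X. r `` {x} \<in> \<Union>\<K>} =
      (\<Union>K\<in>\<K>. {x \<in> topspace X. r `` {x} \<in> K})" for \<K>
    by auto
  show ?thesis
    unfolding istopology_def 1 2 by blast
qed

lemma openin_quotient_topology:
  "openin (quotient_topology X r) U \<longleftrightarrow>
     U \<subseteq> topspace X // r \<and> openin X {x \<in> topspace X. r `` {x} \<in> U}"
  by (simp add: quotient_topology_def istopology_quotient)

lemma topspace_quotient_topology [simp]:
  "topspace (quotient_topology X r) = topspace X // r"
proof
  show "topspace (quotient_topology X r) \<subseteq> topspace X // r"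
    using openin_quotient_topology openin_topspace by blast
  have "{x \<in> topspace X. r `` {x} \<in> topspace X // r} = topspace X"
    by (auto intro: quotientI)
  then have "openin (quotient_topology X r) (topspace X // r)"
    by (simp add: openin_quotient_topology)
  then show "topspace X // r \<subseteq> topspace (quotient_topology X r)"
    by (rule openin_subset)
qed

lemma quotient_map_quotient_topology:
  "quotient_map X (quotient_topology X r) (\<lambda>x. r `` {x})"
  by (auto simp: quotient_map_def openin_quotient_topology quotient_def)


section \<open>Adjunction systems and adjunction spaces\<close>

text \<open>The maps \<open>f i j\<close> are total functions, but only their values on \<open>A i j\<close> matter.\<close>

definition adjunction_system ::
  "'i set \<Rightarrow> ('i \<Rightarrow> 'a topology) \<Rightarrow> ('i \<Rightarrow> 'i \<Rightarrow> 'a set) \<Rightarrow> ('i \<Rightarrow> 'i \<Rightarrow> 'a \<Rightarrow> 'a) \<Rightarrow> bool" where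
  "adjunction_system I X A f \<longleftrightarrow>
     (\<forall>i\<in>I. \<forall>j\<in>I. A i j \<subseteq> topspace (X i)) \<and>
     (\<forall>i\<in>I. \<forall>j\<in>I. continuous_map (subtopology (X i) (A i j)) (X j) (f i j)) \<and>
     (\<forall>i\<in>I. A i i = topspace (X i) \<and> (\<forall>x\<in>topspace (X i). f i i x = x)) \<and>
     (\<forall>i\<in>I. \<forall>j\<in>I. A j i = f i j ` A i j \<and> (\<forall>x\<in>A i j. f j i (f i j x) = x)) \<and>
     (\<forall>i\<in>I. \<forall>j\<in>I. \<forall>k\<in>I. \<forall>a \<in> A i j \<inter> A i k. f i j a \<in> A j k \<and> f i k a = f j k (f i j a))"

text \<open>Following the library's \<^const>\<open>sum_topology\<close>, points of the disjoint union are
  written with the index first, so the class \<open>[x, i]\<close> is that of the pair \<open>(i, x)\<close>.\<close>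

definition adjunction_rel ::
  "'i set \<Rightarrow> ('i \<Rightarrow> 'i \<Rightarrow> 'a set) \<Rightarrow> ('i \<Rightarrow> 'i \<Rightarrow> 'a \<Rightarrow> 'a) \<Rightarrow> ('i \<times> 'a) rel" where
  "adjunction_rel I A f = {((i, x), (j, y)). i \<in> I \<and> j \<in> I \<and> x \<in> A i j \<and> f i j x = y}"

lemma equiv_adjunction_rel:
  assumes "adjunction_system I X A f"
  shows "equiv (topspace (sum_topology X I)) (adjunction_rel I A f)"
proof -
  note adj = assms[unfolded adjunction_system_def]
  have sub: "A i j \<subseteq> topspace (X i)" if "i \<in> I" "j \<in> I" for i j
    using conjunct1[OF adj] that by blast
  have refl: "A i i = topspace (X i)" "x \<in> topspace (X i) \<Longrightarrow> f i i x = x" if "i \<in> I" for i x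
    using conjunct1[OF conjunct2[OF conjunct2[OF adj]]] that by simp_all
  have inv_all: "A j i = f i j ` A i j \<and> (\<forall>x\<in>A i j. f j i (f i j x) = x)"
    if "i \<in> I" "j \<in> I" for i j
    by (rule conjunct1[OF conjunct2[OF conjunct2[OF conjunct2[OF adj]]],
          THEN bspec, OF that(1), THEN bspec, OF that(2)])
  have inv: "f i j x \<in> A j i" "f j i (f i j x) = x" if "i \<in> I" "j \<in> I" "x \<in> A i j" for i j x
    using inv_all[OF that(1,2)] that(3) by (metis imageI, metis)
  have coc: "f i j a \<in> A j k" "f i k a = f j k (f i j a)"
    if "i \<in> I" "j \<in> I" "k \<in> I" "a \<in> A i j" "a \<in> A i k" for i j k a
    using conjunct2[OF conjunct2[OF conjunct2[OF conjunct2[OF adj]]],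
        THEN bspec, OF that(1), THEN bspec, OF that(2), THEN bspec, OF that(3),
        THEN bspec, OF IntI, OF that(4,5)]
    by (rule conjunct1, rule conjunct2)
  show ?thesis
  proof (rule equivI)
    show "adjunction_rel I A f \<subseteq>
        topspace (sum_topology X I) \<times> topspace (sum_topology X I)"
      unfolding adjunction_rel_def topspace_sum_topology comp_def
      using sub inv(1) by blast
    show "refl_on (topspace (sum_topology X I)) (adjunction_rel I A f)"
      using refl by (simp add: refl_on_def adjunction_rel_def)
    show "sym (adjunction_rel I A f)"
    proof (rule symI)
      fix p q
      assume "(p, q) \<in> adjunction_rel I A f"
      then obtain i x j where "p = (i, x)" "q = (j, f i j x)" "i \<in> I" "j \<in> I" "x \<in> A i j"
        unfolding adjunction_rel_def by blast
      then show "(q, p) \<in> adjunction_rel I A f"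
        using inv[of i j x] by (simp add: adjunction_rel_def)
    qed
    show "trans (adjunction_rel I A f)"
    proof (rule transI)
      fix p q r
      assume "(p, q) \<in> adjunction_rel I A f" "(q, r) \<in> adjunction_rel I A f"
      then obtain i x j k where *: "p = (i, x)" "r = (k, f j k (f i j x))"
          "i \<in> I" "j \<in> I" "k \<in> I" "x \<in> A i j" "f i j x \<in> A j k"
        unfolding adjunction_rel_def by blast
      have "x \<in> A i k" "f j k (f i j x) = f i k x"
        using coc[of j i k "f i j x"] inv[of i j x] *(3-7) by simp_all
      then show "(p, r) \<in> adjunction_rel I A f"
        using * by (simp add: adjunction_rel_def)
    qed
  qed
qed

definition adjunction_space ::
  "'i set \<Rightarrow> ('i \<Rightarrow> 'a topology) \<Rightarrow> ('i \<Rightarrow> 'i \<Rightarrow> 'a set) \<Rightarrow> ('i \<Rightarrow> 'i \<Rightarrow> 'a \<Rightarrow> 'a)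
     \<Rightarrow> ('i \<times> 'a) set topology" where
  "adjunction_space I X A f = quotient_topology (sum_topology X I) (adjunction_rel I A f)"

definition canonical_map ::
  "'i set \<Rightarrow> ('i \<Rightarrow> 'i \<Rightarrow> 'a set) \<Rightarrow> ('i \<Rightarrow> 'i \<Rightarrow> 'a \<Rightarrow> 'a) \<Rightarrow> 'i \<Rightarrow> 'a \<Rightarrow> ('i \<times> 'a) set" where
  "canonical_map I A f i x = adjunction_rel I A f `` {(i, x)}"

definition homeomorphic_boundaries ::
  "'i set \<Rightarrow> ('i \<Rightarrow> 'a topology) \<Rightarrow> ('i \<Rightarrow> 'i \<Rightarrow> 'a set) \<Rightarrow> ('i \<Rightarrow> 'i \<Rightarrow> 'a \<Rightarrow> 'a) \<Rightarrow> bool" where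
  "homeomorphic_boundaries I X A f \<longleftrightarrow>
     (\<forall>i\<in>I. \<forall>j\<in>I. i \<noteq> j \<longrightarrow>
        A i j \<subset> topspace (X i) \<and>
        (\<exists>g. homeomorphic_map (subtopology (X i) (X i closure_of A i j))
                              (subtopology (X j) (X j closure_of A j i)) g \<and>
             (\<forall>x\<in>A i j. g x = f i j x)))"


section \<open>Manifolds\<close>

definition locally_Euclidean :: "nat \<Rightarrow> 'a topology \<Rightarrow> bool" where
  "locally_Euclidean n X \<longleftrightarrow>
     (\<forall>x\<in>topspace X. \<exists>U V. openin X U \<and> x \<in> U \<and> openin (Euclidean_space n) V \<and>
        subtopology X U homeomorphic_space subtopology (Euclidean_space n) V)"

definition manifold :: "'a topology \<Rightarrow> bool" where
  "manifold X \<longleftrightarrow>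
     (\<exists>n. locally_Euclidean n X) \<and> second_countable X \<and> connected_space X"

definition Hausdorff_manifold :: "'a topology \<Rightarrow> bool" where
  "Hausdorff_manifold X \<longleftrightarrow> manifold X \<and> Hausdorff_space X"

definition non_Hausdorff_manifold :: "'a topology \<Rightarrow> bool" where
  "non_Hausdorff_manifold X \<longleftrightarrow> manifold X \<and> \<not> Hausdorff_space X"

definition H_submanifold :: "'a topology \<Rightarrow> 'a set \<Rightarrow> bool" where
  "H_submanifold X S \<longleftrightarrow>
     (let P = (\<lambda>T. openin X T \<and> Hausdorff_space (subtopology X T) \<and> connectedin X T)
      in P S \<and> (\<forall>T. P T \<and> S \<subseteq> T \<longrightarrow> T = S))"

end

theory Submission
  imports Defs
begin

text \<open>
  Each \<open>\<phi>\<^sub>i\<close> is an open embedding, so \<open>\<phi>\<^sub>i(M\<^sub>i)\<close> is open, Hausdorff and connected.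
  If \<open>T\<close> is connected and properly contains \<open>\<phi>\<^sub>i(M\<^sub>i)\<close>, then \<open>T\<close> contains a point
  \<open>[y, j]\<close> of the closure of \<open>\<phi>\<^sub>i(M\<^sub>i)\<close> outside \<open>\<phi>\<^sub>i(M\<^sub>i)\<close>, which means that \<open>y\<close> is a boundary
  point of \<open>A\<^sub>j\<^sub>i\<close>. The extension of \<open>f\<^sub>i\<^sub>j\<close> to closures provides a boundary point \<open>x\<close>
  of \<open>A\<^sub>i\<^sub>j\<close> corresponding to \<open>y\<close>, and \<open>[x, i]\<close>, \<open>[y, j]\<close> are distinct points of \<open>T\<close>
  without disjoint neighbourhoods.
\<close>

lemma adjunction_systemD:
  assumes "adjunction_system I X A f" "i \<in> I" "j \<in> I"
  shows "A i j \<subseteq> topspace (X i)"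
    and "continuous_map (subtopology (X i) (A i j)) (X j) (f i j)"
    and "A i i = topspace (X i)"
    and "x \<in> topspace (X i) \<Longrightarrow> f i i x = x"
    and "x \<in> A i j \<Longrightarrow> f i j x \<in> A j i"
    and "x \<in> A i j \<Longrightarrow> f j i (f i j x) = x"
proof -
  note adj = assms(1)[unfolded adjunction_system_def]
  show "A i j \<subseteq> topspace (X i)"
    using adj[THEN conjunct1] assms(2,3) by blast
  show "continuous_map (subtopology (X i) (A i j)) (X j) (f i j)"
    using adj[THEN conjunct2, THEN conjunct1] assms(2,3) by blast
  show "A i i = topspace (X i)" and "x \<in> topspace (X i) \<Longrightarrow> f i i x = x"
    using adj[THEN conjunct2, THEN conjunct2, THEN conjunct1] assms(2) by simp_all
  have "A j i = f i j ` A i j \<and> (\<forall>x\<in>A i j. f j i (f i j x) = x)"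
    by (rule adj[THEN conjunct2, THEN conjunct2, THEN conjunct2, THEN conjunct1,
          THEN bspec, OF assms(2), THEN bspec, OF assms(3)])
  then show "x \<in> A i j \<Longrightarrow> f i j x \<in> A j i" and "x \<in> A i j \<Longrightarrow> f j i (f i j x) = x"
    by (metis imageI, metis)
qed

lemma homeomorphic_boundariesD:
  assumes "homeomorphic_boundaries I X A f" "i \<in> I" "j \<in> I" "i \<noteq> j"
  shows "A i j \<subset> topspace (X i)"
    and "\<exists>g. homeomorphic_map (subtopology (X i) (X i closure_of A i j))
                           (subtopology (X j) (X j closure_of A j i)) g \<and>
             (\<forall>x\<in>A i j. g x = f i j x)"
  using assms unfolding homeomorphic_boundaries_def by simp_all

lemma canonical_map_eq_iff:
  assumes "adjunction_system I X A f" "i \<in> I" "j \<in> I"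
    and "x \<in> topspace (X i)" "y \<in> topspace (X j)"
  shows "canonical_map I A f i x = canonical_map I A f j y \<longleftrightarrow> x \<in> A i j \<and> f i j x = y"
proof -
  have "canonical_map I A f i x = canonical_map I A f j y \<longleftrightarrow>
      ((i, x), (j, y)) \<in> adjunction_rel I A f"
    unfolding canonical_map_def
    by (rule eq_equiv_class_iff[OF equiv_adjunction_rel[OF assms(1)]]) (use assms in auto)
  then show ?thesis
    using assms(2,3) by (simp add: adjunction_rel_def)
qed

lemma topspace_adjunction_space:
  "topspace (adjunction_space I X A f) = (\<Union>i\<in>I. canonical_map I A f i ` topspace (X i))"
  by (auto 4 4 simp: adjunction_space_def quotient_def canonical_map_def)

text \<open>Openness in a disjoint union is tested slice by slice, and the slice over
  \<open>i\<close> of a preimage under the quotient map is a preimage under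
  \<open>canonical_map I A f i\<close>. Openness of a set of classes can thus be checked inside the
  pieces.\<close>

lemma openin_adjunction_space:
  "openin (adjunction_space I X A f) U \<longleftrightarrow>
     U \<subseteq> topspace (adjunction_space I X A f) \<and>
     (\<forall>i\<in>I. openin (X i) {x \<in> topspace (X i). canonical_map I A f i x \<in> U})"
proof -
  have "{x. (i, x) \<in> {p \<in> topspace (sum_topology X I). adjunction_rel I A f `` {p} \<in> U}} =
      {x \<in> topspace (X i). canonical_map I A f i x \<in> U}" if "i \<in> I" for i
    using that by (auto simp: canonical_map_def)
  then show ?thesis
    unfolding adjunction_space_def openin_quotient_topology openin_sum_topology
    by (auto simp: canonical_map_def)
qed

lemma continuous_map_canonical_map:
  assumes "i \<in> I"
  shows "continuous_map (X i) (adjunction_space I X A f) (canonical_map I A f i)"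
  using assms by (auto simp: continuous_map openin_adjunction_space topspace_adjunction_space)

lemma inj_on_canonical_map:
  assumes "adjunction_system I X A f" "i \<in> I"
  shows "inj_on (canonical_map I A f i) (topspace (X i))"
proof (rule inj_onI)
  fix x y
  assume "x \<in> topspace (X i)" "y \<in> topspace (X i)"
    and "canonical_map I A f i x = canonical_map I A f i y"
  then show "x = y"
    using canonical_map_eq_iff[OF assms(1,2,2)] adjunction_systemD(4)[OF assms(1,2,2)] by metis
qed

text \<open>The only point of \<open>X i\<close> that can represent the class of \<open>y\<close> is
  \<open>f j i y\<close>. Hence pulling the image of \<open>U\<close> back to \<open>X j\<close>
  amounts to pulling \<open>U\<close> back along the gluing map.\<close>

lemma canonical_map_in_image_iff:
  assumes "adjunction_system I X A f" "i \<in> I" "j \<in> I"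
    and "U \<subseteq> topspace (X i)" "y \<in> topspace (X j)"
  shows "canonical_map I A f j y \<in> canonical_map I A f i ` U \<longleftrightarrow> y \<in> A j i \<and> f j i y \<in> U"
proof
  assume "canonical_map I A f j y \<in> canonical_map I A f i ` U"
  then obtain x where "x \<in> U" "canonical_map I A f j y = canonical_map I A f i x"
    by blast
  then show "y \<in> A j i \<and> f j i y \<in> U"
    using canonical_map_eq_iff[OF assms(1,3,2,5), of x] assms(4) by blast
next
  assume "y \<in> A j i \<and> f j i y \<in> U"
  then have "canonical_map I A f j y = canonical_map I A f i (f j i y)"
    using canonical_map_eq_iff[OF assms(1,3,2,5)] assms(4) by blast
  then show "canonical_map I A f j y \<in> canonical_map I A f i ` U"
    using \<open>y \<in> A j i \<and> f j i y \<in> U\<close> by blast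
qed

text \<open>Seen from \<open>X j\<close>, the image of \<open>U\<close> is the preimage of
  \<open>U\<close> under the continuous map \<open>f j i\<close>. This is open in
  \<open>A j i\<close>, and therefore in \<open>X j\<close> because the gluing region is
  open.\<close>

lemma open_map_canonical_map:
  assumes "adjunction_system I X A f" "i \<in> I"
    and "\<And>j. j \<in> I \<Longrightarrow> openin (X j) (A j i)"
  shows "open_map (X i) (adjunction_space I X A f) (canonical_map I A f i)"
  unfolding open_map_def openin_adjunction_space
proof (intro allI impI conjI ballI)
  fix U
  assume U: "openin (X i) U"
  note subU = openin_subset[OF U]
  show "canonical_map I A f i ` U \<subseteq> topspace (adjunction_space I X A f)"
    using subU assms(2) by (auto simp: topspace_adjunction_space)
  fix j
  assume j: "j \<in> I"
  note sub = adjunction_systemD(1)[OF assms(1) j assms(2)]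
  have "openin (subtopology (X j) (A j i))
      {y \<in> topspace (subtopology (X j) (A j i)). f j i y \<in> U}"
    by (rule openin_continuous_map_preimage[OF adjunction_systemD(2)[OF assms(1) j assms(2)] U])
  then have "openin (X j) {y \<in> topspace (subtopology (X j) (A j i)). f j i y \<in> U}"
    using openin_trans_full assms(3)[OF j] by blast
  moreover have "{y \<in> topspace (subtopology (X j) (A j i)). f j i y \<in> U} =
      {y \<in> topspace (X j). canonical_map I A f j y \<in> canonical_map I A f i ` U}"
    using canonical_map_in_image_iff[OF assms(1,2) j subU] by auto
  ultimately show
    "openin (X j) {y \<in> topspace (X j). canonical_map I A f j y \<in> canonical_map I A f i ` U}"
    by simp
qed

text \<open>The point \<open>x\<close> is a preimage of \<open>y\<close> under the extension
  \<open>g\<close> of \<open>f i j\<close> to closures. It lies outside \<open>A i j\<close>, as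
  \<open>g\<close> maps that set into \<open>A j i\<close>. Since \<open>x\<close> is a limit of
  points of \<open>A i j\<close> and \<open>g\<close> is continuous, gluing matches points near
  \<open>x\<close> with points near \<open>y\<close>.\<close>

lemma boundary_point_corresponds:
  assumes "adjunction_system I X A f" "homeomorphic_boundaries I X A f"
    and "i \<in> I" "j \<in> I" "i \<noteq> j"
    and "y \<in> X j closure_of A j i" "y \<notin> A j i"
  obtains x where "x \<in> topspace (X i)" "x \<notin> A i j"
    and "\<And>U V. \<lbrakk>openin (X i) U; x \<in> U; openin (X j) V; y \<in> V\<rbrakk> \<Longrightarrow> \<exists>z\<in>A i j \<inter> U. f i j z \<in> V"
proof -
  let ?C = "X i closure_of A i j" and ?D = "X j closure_of A j i"
  obtain g where g: "homeomorphic_map (subtopology (X i) ?C) (subtopology (X j) ?D) g"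
    and gf: "\<And>x. x \<in> A i j \<Longrightarrow> g x = f i j x"
    using homeomorphic_boundariesD(2)[OF assms(2-5)] by blast
  have "g ` topspace (subtopology (X i) ?C) = topspace (subtopology (X j) ?D)"
    using g homeomorphic_imp_surjective_map by blast
  then have "y \<in> g ` ?C"
    using assms(6) by (simp add: closure_of_subset_topspace Int_absorb1)
  then obtain x where x: "x \<in> ?C" "g x = y"
    by blast
  show thesis
  proof
    show "x \<in> topspace (X i)"
      using x(1) by (simp add: in_closure_of)
    show "x \<notin> A i j"
      using gf[of x] x(2) assms(7) adjunction_systemD(5)[OF assms(1,3,4), of x] by auto
    fix U V
    assume UV: "openin (X i) U" "x \<in> U" "openin (X j) V" "y \<in> V"
    have "continuous_map (subtopology (X i) ?C) (X j) g"
      by (rule continuous_map_into_fulltopology[OF homeomorphic_imp_continuous_map[OF g]])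
    then have "openin (subtopology (X i) ?C) {z \<in> topspace (subtopology (X i) ?C). g z \<in> V}"
      by (rule openin_continuous_map_preimage[OF _ UV(3)])
    \<comment> \<open>\<open>g\<close> is defined only on the closure, so the preimage of
      \<open>V\<close> is merely relatively open; \<open>W\<close> extends it to an open set of
      \<open>X i\<close>. Then \<open>U \<inter> W\<close> is a neighbourhood of \<open>x\<close>
      and meets \<open>A i j\<close>.\<close>
    then obtain W where W: "openin (X i) W"
        "{z \<in> topspace (subtopology (X i) ?C). g z \<in> V} = W \<inter> ?C"
      by (auto simp: openin_subtopology)
    have "x \<in> W"
      using W(2) x UV(4) closure_of_subset_topspace[of "X i"] by fastforce
    then obtain z where z: "z \<in> A i j" "z \<in> U" "z \<in> W"
      using x(1) openin_Int[OF UV(1) W(1)] UV(2) unfolding in_closure_of by blast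
    have "z \<in> ?C"
      using z(1) closure_of_subset[OF adjunction_systemD(1)[OF assms(1,3,4)]] by blast
    then have "g z \<in> V"
      using W(2) z(3) by blast
    then show "\<exists>z\<in>A i j \<inter> U. f i j z \<in> V"
      using z gf by auto
  qed
qed

lemma not_Hausdorff_if_boundary_point:
  assumes "adjunction_system I X A f" "homeomorphic_boundaries I X A f"
    and "i \<in> I" "j \<in> I" "i \<noteq> j"
    and "y \<in> X j closure_of A j i" "y \<notin> A j i"
    and T: "openin (adjunction_space I X A f) T" "canonical_map I A f i ` topspace (X i) \<subseteq> T"
      "canonical_map I A f j y \<in> T"
  shows "\<not> Hausdorff_space (subtopology (adjunction_space I X A f) T)"
proof
  let ?S = "adjunction_space I X A f" and ?c = "canonical_map I A f"
  assume haus: "Hausdorff_space (subtopology ?S T)"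
  have y: "y \<in> topspace (X j)"
    using assms(6) by (simp add: in_closure_of)
  obtain x where x: "x \<in> topspace (X i)" "x \<notin> A i j"
    and meet: "\<And>U V. \<lbrakk>openin (X i) U; x \<in> U; openin (X j) V; y \<in> V\<rbrakk>
      \<Longrightarrow> \<exists>z\<in>A i j \<inter> U. f i j z \<in> V"
    using boundary_point_corresponds[OF assms(1-7)] by blast
  have "?c i x \<noteq> ?c j y"
    using canonical_map_eq_iff[OF assms(1,3,4) x(1) y] x(2) by blast
  moreover have "?c i x \<in> topspace (subtopology ?S T)" "?c j y \<in> topspace (subtopology ?S T)"
    using T x(1) openin_subset by auto
  ultimately obtain U V where UV: "openin (subtopology ?S T) U" "openin (subtopology ?S T) V"
      "?c i x \<in> U" "?c j y \<in> V" "disjnt U V"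
    using haus unfolding Hausdorff_space_def by meson
  \<comment> \<open>Openness of \<open>T\<close> makes \<open>U\<close> and \<open>V\<close> open in
    the whole space, so that they pull back to open sets of \<open>X i\<close> and
    \<open>X j\<close>.\<close>
  have "openin ?S U" "openin ?S V"
    using UV(1,2) T(1) openin_trans_full by blast+
  then have "openin (X i) {z \<in> topspace (X i). ?c i z \<in> U}"
    "openin (X j) {z \<in> topspace (X j). ?c j z \<in> V}"
    using assms(3,4) by (auto simp: openin_adjunction_space)
  then obtain z where z: "z \<in> A i j" "z \<in> topspace (X i)" "?c i z \<in> U"
      "f i j z \<in> topspace (X j)" "?c j (f i j z) \<in> V"
    using meet[of "{z \<in> topspace (X i). ?c i z \<in> U}" "{z \<in> topspace (X j). ?c j z \<in> V}"]
      x(1) y UV(3,4) by blast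
  \<comment> \<open>Gluing identifies \<open>z\<close> with \<open>f i j z\<close>, so this one
    class lies in both \<open>U\<close> and \<open>V\<close>, although they are disjoint.\<close>
  then have "?c i z = ?c j (f i j z)"
    using canonical_map_eq_iff[OF assms(1,3,4)] by blast
  then show False
    using z UV(5) by (auto simp: disjnt_iff)
qed

text \<open>As the canonical map of \<open>X j\<close> is open, it sends a neighbourhood of
  \<open>y\<close> to a neighbourhood of its class, which must meet the image of \<open>X i\<close>.
  A common class has a representative in that neighbourhood, and this representative lies in
  \<open>A j i\<close>.\<close>

lemma in_closure_of_canonical_image:
  assumes "adjunction_system I X A f" "i \<in> I" "j \<in> I"
    and "\<And>k. k \<in> I \<Longrightarrow> openin (X k) (A k j)"
    and y: "y \<in> topspace (X j)"
    and cl: "canonical_map I A f j y \<in>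
      adjunction_space I X A f closure_of canonical_map I A f i ` topspace (X i)"
  shows "y \<in> X j closure_of A j i"
  unfolding in_closure_of
proof (intro conjI allI impI)
  fix U
  assume U: "y \<in> U \<and> openin (X j) U"
  then have "openin (adjunction_space I X A f) (canonical_map I A f j ` U)"
    using open_map_canonical_map[OF assms(1,3,4)] by (auto simp: open_map_def)
  moreover have "canonical_map I A f j y \<in> canonical_map I A f j ` U"
    using U by blast
  ultimately have "\<exists>p. p \<in> canonical_map I A f i ` topspace (X i) \<and> p \<in> canonical_map I A f j ` U"
    using cl by (simp add: in_closure_of)
  then obtain z where "z \<in> U"
      "canonical_map I A f j z \<in> canonical_map I A f i ` topspace (X i)"
    by (metis imageE)
  moreover have "z \<in> topspace (X j)"
    using U \<open>z \<in> U\<close> openin_subset by blast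
  ultimately have "z \<in> A j i"
    using canonical_map_in_image_iff[OF assms(1-3) order_refl] by blast
  then show "\<exists>z. z \<in> A j i \<and> z \<in> U"
    using \<open>z \<in> U\<close> by blast
qed (rule y)

text \<open>Otherwise \<open>S\<close> would equal the trace of its closure on \<open>T\<close>,
  hence be clopen in \<open>T\<close>, against connectedness.\<close>

lemma connectedin_open_proper_subset:
  assumes "connectedin X T" "openin X S" "S \<subseteq> T" "S \<noteq> {}" "S \<noteq> T"
  shows "T \<inter> (X closure_of S) - S \<noteq> {}"
proof
  assume *: "T \<inter> (X closure_of S) - S = {}"
  have "T \<inter> (X closure_of S) = S"
    using * assms(3) closure_of_subset[OF openin_subset[OF assms(2)]] by blast
  then have "closedin (subtopology X T) S"
    using closedin_subtopology_Int_closed[OF closedin_closure_of, of X T S] by simp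
  moreover have "openin (subtopology X T) S"
    using assms(2,3) by (auto simp: openin_subtopology)
  moreover have "topspace (subtopology X T) = T"
    using connectedin_subset_topspace[OF assms(1)] by (simp add: Int_absorb1)
  ultimately show False
    using assms(1,4,5) by (auto simp: connectedin_def connected_space_clopen_in)
qed

theorem mainTheorem5:
  fixes I :: "'i set"
    and M :: "'i \<Rightarrow> 'a topology"
    and A :: "'i \<Rightarrow> 'i \<Rightarrow> 'a set"
    and f :: "'i \<Rightarrow> 'i \<Rightarrow> 'a \<Rightarrow> 'a"
  assumes "countable I"
    and "adjunction_system I M A f"
    and "\<And>i. i \<in> I \<Longrightarrow> Hausdorff_manifold (M i)"
    and "\<And>i j. i \<in> I \<Longrightarrow> j \<in> I \<Longrightarrow> openin (M i) (A i j)"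
    and "homeomorphic_boundaries I M A f"
    and "non_Hausdorff_manifold (adjunction_space I M A f)"
    and "i \<in> I"
  shows "H_submanifold (adjunction_space I M A f) (canonical_map I A f i ` topspace (M i))"
proof -
  let ?S = "adjunction_space I M A f" and ?c = "canonical_map I A f"
  note adj = \<open>adjunction_system I M A f\<close>
  note opn = \<open>\<And>i j. i \<in> I \<Longrightarrow> j \<in> I \<Longrightarrow> openin (M i) (A i j)\<close>
  note hom = \<open>homeomorphic_boundaries I M A f\<close> and i = \<open>i \<in> I\<close>
  have Mi: "Hausdorff_space (M i)" "connected_space (M i)"
    using assms(3)[OF i] by (auto simp: Hausdorff_manifold_def manifold_def)
  note opm = open_map_canonical_map[OF adj i opn[OF _ i]]
  note cont = continuous_map_canonical_map[OF i, of M A f]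
  have "embedding_map (M i) ?S (?c i)"
    by (rule injective_open_imp_embedding_map[OF cont opm inj_on_canonical_map[OF adj i]])
  then have haus: "Hausdorff_space (subtopology ?S (?c i ` topspace (M i)))"
    using Mi(1) embedding_map_imp_homeomorphic_space homeomorphic_Hausdorff_space by blast
  have opS: "openin ?S (?c i ` topspace (M i))"
    using opm by (simp add: open_map_def)
  have conn: "connectedin ?S (?c i ` topspace (M i))"
    using connectedin_continuous_map_image[OF cont] Mi(2) by (simp add: connectedin_topspace)
  \<comment> \<open>The empty space counts as a manifold. It is excluded here because gluing regions are proper
    subsets, so an empty \<open>M i\<close> is the only piece and then \<open>?S\<close> is empty.\<close>
  have ne: "topspace (M i) \<noteq> {}"
  proof
    assume empty: "topspace (M i) = {}"
    then have "j = i" if "j \<in> I" for j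
      using homeomorphic_boundariesD(1)[OF hom i that] by blast
    then have "topspace ?S = {}"
      using empty by (auto simp: topspace_adjunction_space)
    then show False
      using assms(6) by (auto simp: non_Hausdorff_manifold_def Hausdorff_space_def)
  qed
  have "T = ?c i ` topspace (M i)"
    if T: "openin ?S T" "Hausdorff_space (subtopology ?S T)" "connectedin ?S T"
      "?c i ` topspace (M i) \<subseteq> T" for T
  proof (rule ccontr)
    assume "T \<noteq> ?c i ` topspace (M i)"
    then obtain p where p: "p \<in> T" "p \<in> ?S closure_of (?c i ` topspace (M i))"
        "p \<notin> ?c i ` topspace (M i)"
      using connectedin_open_proper_subset[OF T(3) opS T(4)] ne by blast
    then obtain j y where j: "j \<in> I" and y: "y \<in> topspace (M j)" and py: "p = ?c j y"
      using subsetD[OF openin_subset[OF T(1)] p(1)] by (auto simp: topspace_adjunction_space)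
    have "i \<noteq> j"
      using p(3) y py by blast
    moreover have "y \<in> M j closure_of A j i"
      using in_closure_of_canonical_image[OF adj i j opn[OF _ j] y] p(2) py by blast
    moreover have "y \<notin> A j i"
    proof
      assume "y \<in> A j i"
      then have "f j i y \<in> topspace (M i)"
        using adjunction_systemD(1)[OF adj i j] adjunction_systemD(5)[OF adj j i] by blast
      then show False
        using canonical_map_in_image_iff[OF adj i j order_refl y] \<open>y \<in> A j i\<close> p(3) py by blast
    qed
    ultimately show False
      using not_Hausdorff_if_boundary_point[OF adj hom i j _ _ _ T(1,4)] p(1) py T(2) by blast
  qed
  then show ?thesis
    unfolding H_submanifold_def Let_def using opS haus conn by blast
qed

end
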